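(* Let $K=\mathbb{Q}(\sqrt2)$, so $\mathcal{O}_K=\mathbb{Z}[\sqrt2]$, and put $\varepsilon=3+2\sqrt2$, $\beta=2+\sqrt2$ and $g(z)=(2z-\tau(z))^2$. Then the generalized quadratic form in the twelve variables $x_1,\dots,x_4,z_1,\dots,z_8$ over $K$ $$G=x_1^2+x_2^2+x_3^2+x_4^2+g(z_1)+\varepsilon g(z_2)+\varepsilon^2g(z_3)+\varepsilon^3g(z_4)+\beta g(z_5)+\varepsilon\beta g(z_6)+\varepsilon^2\beta g(z_7)+\varepsilon^3\beta g(z_8)$$ is totally positive semidefinite and universal, but has no universal quadratic subform (no subform of $G$ without proper variables is universal).
   Context: $K=\mathbb{Q}(\sqrt D)\subset\mathbb{R}$ is a real quadratic field (here $D=2$), $\mathcal{O}_K$ its ring of integers, and $\tau:K\to K$, $a+b\sqrt D\mapsto a-b\sqrt D$, its non-trivial automorphism. An element $\alpha\in K$ is totally positive, written $\alpha\succ0$, if $\alpha>0$ and $\tau(\alpha)>0$; write $\alpha\succeq 0$ if $\alpha\ge0$ and $\tau(\alpha)\ge0$. $\mathcal{O}_K^+$ is the set of totally positive elements of $\mathcal{O}_K$. A quadratic form over $K$ in $n$ variables is a homogeneous quadratic polynomial $Q(x_1,\dots,x_n)=\sum_{1\le i\le j\le n}a_{ij}x_ix_j$ with $a_{ij}\in K$; it is integral if all $a_{ij}\in\mathcal{O}_K$. It is totally positive definite (resp. semidefinite) if $Q(x)\succ0$ (resp. $Q(x)\succeq0$) for all $x\in K^n\setminus\{0\}$. A generalized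 quadratic form (generalized form) in $r$ variables over $K$ is an expression $G(z_1,\dots,z_r)=G_0(z_1,\tau(z_1),\dots,z_r,\tau(z_r))$, where $G_0$ is a quadratic form in $2r$ variables over $K$. It is integral if $G_0$ is integral. We say that $z_i$ (resp. $\tau(z_i)$) appears in $G$ if some monomial with non-zero coefficient in $G_0$ involves the corresponding variable of $G_0$. A variable $z_i$ is a proper variable of $G$ if both $z_i$ and $\tau(z_i)$ appear in $G$. $G$ is called quadratic if it has no proper variables. Associated quadratic form: after reordering, let $z_1,\dots,z_\ell$ be the non-proper variables and $z_{\ell+1},\dots,z_r$ the proper variables of $G$. The associated quadratic form of $G$ is the quadratic form $Q$ in $2r-\ell$ variables with $G(z_1,\dots,z_r)=Q(z_1',\dots,z_\ell',z_{\ell+1},\tau(z_{\ell+1}),\dots,z_r,\tau(z_r))$ (as formal expressions, treating each $z_i$ and $\tau(z_i)$ as separate variables), where for $j\le\ell$, $z_j'$ is whichever of $z_j$, $\tau(z_j)$ appears in $G$ (if neither appears, put $z_j'=z_j$). $G$ is totally positive definite (resp. semidefinite) if its associated quadratic form $Q$ is totally positive definite (resp. semidefinite). An integral generalized form $G$ represents $\alpha\in\mathcal{O}_K$ if $G(\beta_1,\dots,\beta_r)=\alpha$ for some $\beta_1,\dots,\beta_r\in\mathcal{O}_K$. A totally positive semidefinite integral generalized form is universal if it represents every element of $\mathcal{O}_K^+$. A generalized form $H(z_1,\dots,z_k)$ is a subform of $G(z_1,\dots,z_r)$ if, after some reordering of the variables of $G$, $H(z_1,\dots,z_k)=G(z_1,\dots,z_k,0,\dots,0)$.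 *)

theory Defs
  imports Complex_Main "HOL-Computational_Algebra.Polynomial" "HOL-Combinatorics.Permutations"
begin

section \<open>The field \<open>\<rat>(\<surd>2)\<close>\<close>

definition K :: "real set" where
  "K = {a + b * sqrt 2 | a b. a \<in> \<rat> \<and> b \<in> \<rat>}"

definition tau :: "real \<Rightarrow> real" where
  "tau x = (THE y. \<exists>a\<in>\<rat>. \<exists>b\<in>\<rat>. x = a + b * sqrt 2 \<and> y = a - b * sqrt 2)"

definition OK :: "real set" where
  "OK = {x \<in> K. algebraic_int x}"

definition totally_pos :: "real \<Rightarrow> bool" where
  "totally_pos x \<longleftrightarrow> 0 < x \<and> 0 < tau x"

definition totally_nonneg :: "real \<Rightarrow> bool" where
  "totally_nonneg x \<longleftrightarrow> 0 \<le> x \<and> 0 \<le> tau x"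

definition OK_pos :: "real set" where
  "OK_pos = {x \<in> OK. totally_pos x}"

lemma sqrt2_irrational: "sqrt 2 \<notin> \<rat>"
proof
  assume "sqrt 2 \<in> \<rat>"
  moreover have "algebraic_int (sqrt 2)"
    by (rule algebraic_int_sqrt) auto
  ultimately have "sqrt 2 \<in> \<int>"
    by (rule rational_algebraic_int_is_int[rotated])
  then obtain k :: int where k: "sqrt 2 = of_int k" by (elim Ints_cases)
  have "1 < sqrt 2" "sqrt 2 < 2" by (auto intro: real_less_lsqrt)
  with k show False by simp
qed

lemma tau_eq:
  assumes "a \<in> \<rat>" "b \<in> \<rat>"
  shows "tau (a + b * sqrt 2) = a - b * sqrt 2"
  unfolding tau_def
proof (rule the_equality)
  show "\<exists>c\<in>\<rat>. \<exists>d\<in>\<rat>. a + b * sqrt 2 = c + d * sqrt 2 \<and> a - b * sqrt 2 = c - d * sqrt 2"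
    using assms by blast
next
  fix y assume "\<exists>c\<in>\<rat>. \<exists>d\<in>\<rat>. a + b * sqrt 2 = c + d * sqrt 2 \<and> y = c - d * sqrt 2"
  then obtain c d where cd: "c \<in> \<rat>" "d \<in> \<rat>" "a + b * sqrt 2 = c + d * sqrt 2"
    and y: "y = c - d * sqrt 2" by blast
  have "b = d"
  proof (rule ccontr)
    assume "b \<noteq> d"
    with cd(3) have "sqrt 2 = (c - a) / (b - d)" by (simp add: field_simps)
    with cd assms have "sqrt 2 \<in> \<rat>" by (metis Rats_diff Rats_divide)
    with sqrt2_irrational show False by blast
  qed
  with cd(3) y show "y = a - b * sqrt 2" by simp
qed


section \<open>Quadratic forms\<close>

text \<open>
  \<open>QForm n a\<close> is the polynomial \<open>\<Sum>i\<le>j<n. a i j * X\<^sub>i * X\<^sub>j\<close>, with variables numbered from 0.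
  The coefficients outside \<open>i \<le> j < n\<close> carry no information; forms over a
  set of coefficients are required to have zeros there.
\<close>

datatype qform = QForm (qvars: nat) (qcoeff: "nat \<Rightarrow> nat \<Rightarrow> real")

definition qf_over :: "real set \<Rightarrow> qform \<Rightarrow> bool" where
  "qf_over S Q \<longleftrightarrow>
     (\<forall>i j. if i \<le> j \<and> j < qvars Q then qcoeff Q i j \<in> S else qcoeff Q i j = 0)"

definition qf_eval :: "qform \<Rightarrow> (nat \<Rightarrow> real) \<Rightarrow> real" where
  "qf_eval Q x = (\<Sum>i<qvars Q. \<Sum>j\<in>{i..<qvars Q}. qcoeff Q i j * x i * x j)"

definition qf_totally_pos_semidef :: "qform \<Rightarrow> bool" where
  "qf_totally_pos_semidef Q \<longleftrightarrow>
     (\<forall>x. (\<forall>i<qvars Q. x i \<in> K) \<and> (\<exists>i<qvars Q. x i \<noteq> 0) \<longrightarrow> totally_nonneg (qf_eval Q x))"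

text \<open>The coefficient of the monomial \<open>X\<^sub>i * X\<^sub>j\<close>, for \<open>i\<close> and \<open>j\<close> in any order.\<close>

definition monom_coeff :: "qform \<Rightarrow> nat \<Rightarrow> nat \<Rightarrow> real" where
  "monom_coeff Q i j = qcoeff Q (min i j) (max i j)"

definition qf_appears :: "qform \<Rightarrow> nat \<Rightarrow> bool" where
  "qf_appears Q k \<longleftrightarrow>
     (\<exists>i j. i \<le> j \<and> j < qvars Q \<and> qcoeff Q i j \<noteq> 0 \<and> (k = i \<or> k = j))"


section \<open>Generalized quadratic forms\<close>

text \<open>
  In \<open>GForm r a\<close>, the function \<open>a\<close> gives the coefficients of \<open>G\<^sub>0\<close>, a quadratic form in
  \<open>2 * r\<close> variables. Its variable \<open>2 * k\<close> stands for \<open>z\<^sub>k\<close> and its variable \<open>2 * k + 1\<close>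
  for \<open>\<tau>(z\<^sub>k)\<close>, where \<open>k < r\<close>.
\<close>

datatype gform = GForm (gvars: nat) (gcoeff: "nat \<Rightarrow> nat \<Rightarrow> real")

definition G0 :: "gform \<Rightarrow> qform" where
  "G0 G = QForm (2 * gvars G) (gcoeff G)"

definition gf_over_K :: "gform \<Rightarrow> bool" where
  "gf_over_K G \<longleftrightarrow> qf_over K (G0 G)"

definition gf_integral :: "gform \<Rightarrow> bool" where
  "gf_integral G \<longleftrightarrow> qf_over OK (G0 G)"

definition gf_eval :: "gform \<Rightarrow> (nat \<Rightarrow> real) \<Rightarrow> real" where
  "gf_eval G z = qf_eval (G0 G) (\<lambda>i. if even i then z (i div 2) else tau (z (i div 2)))"

definition z_appears :: "gform \<Rightarrow> nat \<Rightarrow> bool" where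
  "z_appears G k \<longleftrightarrow> qf_appears (G0 G) (2 * k)"

definition tau_z_appears :: "gform \<Rightarrow> nat \<Rightarrow> bool" where
  "tau_z_appears G k \<longleftrightarrow> qf_appears (G0 G) (2 * k + 1)"

definition proper_var :: "gform \<Rightarrow> nat \<Rightarrow> bool" where
  "proper_var G k \<longleftrightarrow> z_appears G k \<and> tau_z_appears G k"

definition gf_quadratic :: "gform \<Rightarrow> bool" where
  "gf_quadratic G \<longleftrightarrow> (\<forall>k<gvars G. \<not> proper_var G k)"

text \<open>
  The variables of \<open>G\<^sub>0\<close> that become the variables of the associated quadratic form: first
  one variable \<open>z\<^sub>k'\<close> for each non-proper \<open>z\<^sub>k\<close>, then \<open>z\<^sub>k\<close> and \<open>\<tau>(z\<^sub>k)\<close> for each proper \<open>z\<^sub>k\<close>.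
\<close>

definition assoc_vars :: "gform \<Rightarrow> nat list" where
  "assoc_vars G =
     map (\<lambda>k. if tau_z_appears G k then 2 * k + 1 else 2 * k)
         (filter (\<lambda>k. \<not> proper_var G k) [0..<gvars G]) @
     concat (map (\<lambda>k. [2 * k, 2 * k + 1]) (filter (proper_var G) [0..<gvars G]))"

definition assoc_qform :: "gform \<Rightarrow> qform" where
  "assoc_qform G =
     (let vs = assoc_vars G; n = length vs
      in QForm n (\<lambda>i j. if i \<le> j \<and> j < n then monom_coeff (G0 G) (vs ! i) (vs ! j) else 0))"

definition gf_totally_pos_semidef :: "gform \<Rightarrow> bool" where
  "gf_totally_pos_semidef G \<longleftrightarrow> qf_totally_pos_semidef (assoc_qform G)"

definition represents :: "gform \<Rightarrow> real \<Rightarrow> bool" where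
  "represents G \<alpha> \<longleftrightarrow> (\<exists>z. (\<forall>k<gvars G. z k \<in> OK) \<and> gf_eval G z = \<alpha>)"

text \<open>
  Universality is only spoken of for totally positive semidefinite integral forms. These
  properties are not part of the predicate below; they are stated separately.
\<close>

definition universal :: "gform \<Rightarrow> bool" where
  "universal G \<longleftrightarrow> (\<forall>\<alpha>\<in>OK_pos. represents G \<alpha>)"

text \<open>
  The \<open>k\<close>-th variable of \<open>gf_reorder p G\<close> is variable number \<open>p k\<close> of \<open>G\<close>; \<open>gf_restrict k G\<close> is
  \<open>G(z\<^sub>0, \<dots>, z\<^sub>k\<^sub>-\<^sub>1, 0, \<dots>, 0)\<close>, which keeps exactly the monomials in the first \<open>k\<close>
  variables and their conjugates.
\<close>

definition gf_reorder :: "(nat \<Rightarrow> nat) \<Rightarrow> gform \<Rightarrow> gform" where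
  "gf_reorder p G =
     (let v = (\<lambda>i. 2 * p (i div 2) + i mod 2)
      in GForm (gvars G) (\<lambda>i j. if i \<le> j then monom_coeff (G0 G) (v i) (v j) else 0))"

definition gf_restrict :: "nat \<Rightarrow> gform \<Rightarrow> gform" where
  "gf_restrict k G = GForm k (\<lambda>i j. if i \<le> j \<and> j < 2 * k then gcoeff G i j else 0)"

definition subform :: "gform \<Rightarrow> gform \<Rightarrow> bool" where
  "subform H G \<longleftrightarrow>
     (\<exists>p k. p permutes {..<gvars G} \<and> k \<le> gvars G \<and> H = gf_restrict k (gf_reorder p G))"


section \<open>The form in twelve variables\<close>

text \<open>
  \<open>lin_sq l\<close> gives the coefficients of the square of the linear form \<open>\<Sum>i. l i * X\<^sub>i\<close>.
  The linear forms \<open>zv k\<close> and \<open>tzv k\<close> are \<open>z\<^sub>k\<close> and \<open>\<tau>(z\<^sub>k)\<close>.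
\<close>

definition lin_sq :: "(nat \<Rightarrow> real) \<Rightarrow> nat \<Rightarrow> nat \<Rightarrow> real" where
  "lin_sq l i j = (if i = j then l i ^ 2 else if i < j then 2 * l i * l j else 0)"

definition zv :: "nat \<Rightarrow> nat \<Rightarrow> real" where
  "zv k i = (if i = 2 * k then 1 else 0)"

definition tzv :: "nat \<Rightarrow> nat \<Rightarrow> real" where
  "tzv k i = (if i = 2 * k + 1 then 1 else 0)"

definition x_sq :: "nat \<Rightarrow> nat \<Rightarrow> nat \<Rightarrow> real" where
  "x_sq k = lin_sq (zv k)"

definition g :: "nat \<Rightarrow> nat \<Rightarrow> nat \<Rightarrow> real" where
  "g k = lin_sq (\<lambda>i. 2 * zv k i - tzv k i)"

definition eps :: real where
  "eps = 3 + 2 * sqrt 2"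

definition beta :: real where
  "beta = 2 + sqrt 2"

text \<open>The variables \<open>x\<^sub>1, \<dots>, x\<^sub>4\<close> have numbers 0 to 3 and \<open>z\<^sub>1, \<dots>, z\<^sub>8\<close> have numbers 4 to 11.\<close>

definition form12 :: gform where
  "form12 = GForm 12 (\<lambda>i j.
     x_sq 0 i j + x_sq 1 i j + x_sq 2 i j + x_sq 3 i j
     + g 4 i j + eps * g 5 i j + eps ^ 2 * g 6 i j + eps ^ 3 * g 7 i j
     + beta * g 8 i j + eps * beta * g 9 i j + eps ^ 2 * beta * g 10 i j
     + eps ^ 3 * beta * g 11 i j)"

lemma lin_sq_eval:
  "qf_eval (QForm n (lin_sq l)) x = (\<Sum>i<n. l i * x i) ^ 2"
proof (induction n)
  case 0
  show ?case by (simp add: qf_eval_def)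
next
  case (Suc n)
  have "qf_eval (QForm (Suc n) (lin_sq l)) x =
      (\<Sum>i<n. (\<Sum>j\<in>{i..<n}. lin_sq l i j * x i * x j) + lin_sq l i n * x i * x n)
      + lin_sq l n n * x n * x n"
    by (simp add: qf_eval_def)
  also have "\<dots> = qf_eval (QForm n (lin_sq l)) x
      + (\<Sum>i<n. lin_sq l i n * x i * x n) + lin_sq l n n * x n * x n"
    by (simp add: qf_eval_def sum.distrib)
  also have "(\<Sum>i<n. lin_sq l i n * x i * x n) = 2 * (\<Sum>i<n. l i * x i) * (l n * x n)"
    unfolding sum_distrib_left sum_distrib_right
    by (intro sum.cong) (auto simp: lin_sq_def)
  also have "lin_sq l n n = l n ^ 2"
    by (simp add: lin_sq_def)
  finally show ?case
    unfolding Suc.IH by (simp add: power2_eq_square algebra_simps)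
qed

lemma form12_eval:
  fixes z :: "nat \<Rightarrow> real"
  defines "h \<equiv> \<lambda>k. (2 * z k - tau (z k)) ^ 2"
  shows "gf_eval form12 z =
    z 0 ^ 2 + z 1 ^ 2 + z 2 ^ 2 + z 3 ^ 2
    + h 4 + eps * h 5 + eps ^ 2 * h 6 + eps ^ 3 * h 7
    + beta * h 8 + eps * beta * h 9 + eps ^ 2 * beta * h 10 + eps ^ 3 * beta * h 11"
proof -
  let ?x = "\<lambda>i. if even i then z (i div 2) else tau (z (i div 2))"
  define E where "E = (\<lambda>c. qf_eval (QForm 24 c) ?x)"
  have add: "E (\<lambda>i j. a i j + b i j) = E a + E b" for a b
    by (simp add: E_def qf_eval_def sum.distrib algebra_simps)
  have scale: "E (\<lambda>i j. c * a i j) = c * E a" for c a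
    by (simp add: E_def qf_eval_def sum_distrib_left mult.assoc)
  have x: "E (x_sq k) = z k ^ 2" if "k < 12" for k
    using that by (simp add: E_def x_sq_def lin_sq_eval zv_def if_distrib[of "\<lambda>c. c * _"] cong: if_cong)
  have gk: "E (g k) = h k" if "k < 12" for k
  proof -
    have "(\<Sum>i<24. (2 * zv k i - tzv k i) * ?x i)
        = (\<Sum>i<24. (if i = 2 * k then 2 * ?x i else 0) - (if i = 2 * k + 1 then ?x i else 0))"
      by (intro sum.cong) (auto simp: zv_def tzv_def)
    also have "\<dots> = 2 * z k - tau (z k)"
      using that by (subst sum_subtractf) (simp add: sum.delta)
    finally show ?thesis by (simp add: E_def g_def lin_sq_eval h_def)
  qed
  have "gf_eval form12 z = E (gcoeff form12)"
    by (simp add: gf_eval_def G0_def E_def form12_def)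
  then show ?thesis by (simp add: form12_def add scale x gk)
qed

end

(*
  The set of values of G is stable under multiplication by eps and 1/eps. Up to such a
  multiplication every totally positive element has the form c + d eps + e beta with integers
  c, d >= 0 and e in {0,1}: reduce m + n sqrt 2 until m >= 2|n| and use 2 beta = 1 + eps. Taking
  integer multiples of 1, sqrt 2, 1 + sqrt 2 and 2 + sqrt 2 for the x_i and suitable
  z_1, ..., z_4, the coefficients c and d become independent values of a^2 + b^2 + 2c^2 + 2d^2,
  which is universal over the integers by Lagrange's four-square theorem; e is a value of
  g(z_5). A quadratic subform involves only the x_i, and no sum of squares in Z[sqrt 2] equals
  beta, because its coefficient at sqrt 2 is even.
*)

theory Submission imports Defs begin

section \<open>Sums of four squares\<close>

definition sum4 :: "int \<Rightarrow> bool" where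
  "sum4 n \<longleftrightarrow> (\<exists>a b c d. n = a^2 + b^2 + c^2 + d^2)"

text \<open>Multiplicativity of the quaternion norm, for the product of one quaternion with the
  conjugate of the other. With these signs all four bilinear terms are divisible by m when the
  quadruples agree modulo m and have norm divisible by m.\<close>

lemma euler_four_squares:
  fixes a b c d e f g h :: "'a :: comm_ring_1"
  shows "(a^2 + b^2 + c^2 + d^2) * (e^2 + f^2 + g^2 + h^2) =
    (a*e + b*f + c*g + d*h)^2 + (a*f - b*e + c*h - d*g)^2
    + (a*g - c*e + d*f - b*h)^2 + (a*h - d*e + b*g - c*f)^2"
  by (simp add: power2_eq_square algebra_simps)

lemma sum4_mult:
  assumes "sum4 m" "sum4 n"
  shows "sum4 (m * n)"
proof -
  obtain a b c d where m: "m = a^2 + b^2 + c^2 + d^2" using assms(1) unfolding sum4_def by blast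
  obtain e f g h where n: "n = e^2 + f^2 + g^2 + h^2" using assms(2) unfolding sum4_def by blast
  show ?thesis unfolding m n euler_four_squares sum4_def by blast
qed

text \<open>Pigeonhole modulo \<open>p\<close>: on the (p + 1)/2 integers from 0 to (p - 1)/2 both
  x^2 and -1 - y^2 are injective modulo \<open>p\<close>, so the two value sets are too large to be
  disjoint.\<close>

lemma prime_dvd_sum_squares_plus_1:
  fixes p :: int
  assumes p: "prime p" "odd p"
  obtains x y where "0 \<le> x" "2 * x < p" "0 \<le> y" "2 * y < p" "p dvd x^2 + y^2 + 1"
proof -
  define A where "A = {0..(p - 1) div 2}"
  have A: "0 \<le> x \<and> 2 * x < p" if "x \<in> A" for x
    using that p(2) by (auto simp: A_def elim!: oddE)
  have inj: "x = y" if xy: "x \<in> A" "y \<in> A" "p dvd x^2 - y^2" for x y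
  proof -
    have "p dvd (x - y) * (x + y)"
      using xy(3) by (simp add: power2_eq_square algebra_simps)
    then have "p dvd x - y \<or> p dvd x + y"
      using p(1) by (simp add: prime_dvd_mult_iff)
    moreover have "\<bar>x - y\<bar> < p" "\<bar>x + y\<bar> < p" using A[OF xy(1)] A[OF xy(2)] by auto
    moreover have "z = 0" if "p dvd z" "\<bar>z\<bar> < p" for z
      using dvd_imp_le_int[of z p] that by auto
    ultimately have "x - y = 0 \<or> x + y = 0" by blast
    then show ?thesis using A[OF xy(1)] A[OF xy(2)] by auto
  qed
  let ?f = "\<lambda>x. x^2 mod p" and ?h = "\<lambda>y. (- 1 - y^2) mod p"
  have p0: "p > 0" using p(1) prime_gt_0_int by blast
  have "inj_on ?f A" by (rule inj_onI) (metis inj mod_eq_dvd_iff)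
  moreover have "inj_on ?h A"
  proof (rule inj_onI)
    fix x y assume xy: "x \<in> A" "y \<in> A" "?h x = ?h y"
    then have "p dvd (- 1 - x^2) - (- 1 - y^2)" by (simp only: mod_eq_dvd_iff)
    then have "p dvd y^2 - x^2" by simp
    then show "x = y" using inj xy by metis
  qed
  ultimately have card: "card (?f ` A) = card A" "card (?h ` A) = card A"
    by (simp_all add: card_image)
  have "card (?f ` A \<union> ?h ` A) \<le> card {0..<p}"
    using p0 by (intro card_mono) auto
  moreover have "2 * card A > card {0..<p}" using p(2) p0 by (auto simp: A_def elim!: oddE)
  ultimately have "?f ` A \<inter> ?h ` A \<noteq> {}"
    using card card_Un_disjoint[of "?f ` A" "?h ` A"] by (auto simp: A_def)
  then obtain x y where xy: "x \<in> A" "y \<in> A" "?f x = ?h y" by blast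
  then have "p dvd x^2 + y^2 + 1" by (simp add: mod_eq_dvd_iff algebra_simps)
  then show ?thesis using that A xy by blast
qed

lemma centered_residue:
  fixes a m :: int
  assumes "m > 0"
  obtains b k where "a = b + m * k" "2 * \<bar>b\<bar> \<le> m"
proof (cases "2 * (a mod m) \<le> m")
  case True
  have "a = a mod m + m * (a div m)" by simp
  then show ?thesis using True assms by (intro that[of "a mod m" "a div m"]) auto
next
  case False
  have "a = (a mod m - m) + m * (a div m + 1)" by (simp add: algebra_simps)
  moreover have "a mod m < m" using assms by simp
  ultimately show ?thesis using False by (intro that[of "a mod m - m" "a div m + 1"]) auto
qed

text \<open>Classical descent: reduce the four bases to least absolute residues modulo
  \<open>m\<close>, multiply the two sums of squares by \<open>euler_four_squares\<close> and cancel
  m^2. The extreme values r = 0 and r = m would make \<open>m\<close> a divisor of the prime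
  \<open>p\<close>.\<close>

lemma sum4_descent:
  fixes m p :: int
  assumes p: "prime p" and m: "1 < m" "m < p" and "sum4 (m * p)"
  obtains r where "0 < r" "r < m" "sum4 (r * p)"
proof -
  obtain a b c d where abcd: "m * p = a^2 + b^2 + c^2 + d^2"
    using assms(4) unfolding sum4_def by blast
  have m0: "m > 0" using m by simp
  obtain e i where e: "a = e + m * i" "2 * \<bar>e\<bar> \<le> m" using centered_residue[OF m0] by blast
  obtain f j where f: "b = f + m * j" "2 * \<bar>f\<bar> \<le> m" using centered_residue[OF m0] by blast
  obtain g k where g: "c = g + m * k" "2 * \<bar>g\<bar> \<le> m" using centered_residue[OF m0] by blast
  obtain h l where h: "d = h + m * l" "2 * \<bar>h\<bar> \<le> m" using centered_residue[OF m0] by blast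
  \<comment> \<open>Passing to the residues lowers the sum of squares by m s, leaving m (p -
    s).\<close>
  define s where "s = i * (2 * e + m * i) + j * (2 * f + m * j) + k * (2 * g + m * k) + l * (2 * h + m * l)"
  define r where "r = p - s"
  have r: "e^2 + f^2 + g^2 + h^2 = m * r"
    using abcd unfolding r_def s_def e f g h by (simp add: power2_eq_square algebra_simps)
  have not_dvd: "\<not> m dvd p"
  proof
    assume "m dvd p"
    then have "m = 1 \<or> m = p" using p m0 by (auto simp: prime_int_iff)
    then show False using m by simp
  qed
  have sq: "4 * x^2 \<le> m^2" if "2 * \<bar>x\<bar> \<le> m" for x :: int
    using power_mono[OF that, of 2] by (simp add: power_mult_distrib)
  note sqs = sq[OF e(2)] sq[OF f(2)] sq[OF g(2)] sq[OF h(2)]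
  have "m * r \<le> m * m" using sqs r unfolding power2_eq_square by linarith
  then have "r \<le> m" using m0 by simp
  have "m * r \<ge> 0" unfolding r[symmetric] by simp
  then have "r \<ge> 0" using m0 by (simp add: zero_le_mult_iff)
  have "r \<noteq> 0"
  proof
    assume "r = 0"
    then have "e^2 + f^2 + g^2 + h^2 = 0" using r by simp
    moreover have "e^2 \<ge> 0" "f^2 \<ge> 0" "g^2 \<ge> 0" "h^2 \<ge> 0" by simp_all
    ultimately have "e^2 = 0" "f^2 = 0" "g^2 = 0" "h^2 = 0" by linarith+
    then have "e = 0" "f = 0" "g = 0" "h = 0" by simp_all
    then have "m * p = m * (m * (i^2 + j^2 + k^2 + l^2))"
      using abcd e f g h by (simp add: power2_eq_square algebra_simps)
    then have "p = m * (i^2 + j^2 + k^2 + l^2)" using m0 by simp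
    then show False using not_dvd by simp
  qed
  moreover have "r \<noteq> m"
  proof
    assume rm: "r = m"
    then have "e^2 + f^2 + g^2 + h^2 = m^2" using r by (simp add: power2_eq_square)
    \<comment> \<open>Four terms, each at most m^2/4, add up to m^2, so every bound is attained and
      each residue is m/2 up to sign.\<close>
    then have "4 * e^2 = m^2" "4 * f^2 = m^2" "4 * g^2 = m^2" "4 * h^2 = m^2"
      using sqs by linarith+
    moreover have "m dvd 2 * x" if "4 * x^2 = m^2" for x :: int
    proof -
      have "(2 * x)^2 = m^2" using that by (simp add: power_mult_distrib)
      then have "2 * x = m \<or> 2 * x = - m" by (rule power2_eq_iff[THEN iffD1])
      then show ?thesis by auto
    qed
    ultimately have "m dvd 2 * e" "m dvd 2 * f" "m dvd 2 * g" "m dvd 2 * h" by blast+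
    moreover have "m dvd t * (y + m * t)" if "m dvd y" for t y :: int
      using that by (simp add: dvd_mult)
    ultimately have "m dvd s" unfolding s_def by (intro dvd_add) simp_all
    then have "m dvd r + s" using rm by simp
    then have "m dvd p" by (simp add: r_def)
    then show False using not_dvd by simp
  qed
  moreover have "sum4 (r * p)"
  proof -
    \<comment> \<open>\<open>A\<close>, \<open>B\<close>, \<open>C\<close>, \<open>D\<close> are the
      quotients by \<open>m\<close> of the four terms of Euler's identity.\<close>
    define A where "A = r + i * e + j * f + k * g + l * h"
    define B where "B = i * f - j * e + k * h - l * g"
    define C where "C = i * g - k * e + l * f - j * h"
    define D where "D = i * h - l * e + j * g - k * f"
    have "m^2 * (r * p) = (a^2 + b^2 + c^2 + d^2) * (e^2 + f^2 + g^2 + h^2)"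
      unfolding abcd[symmetric] r by (simp add: power2_eq_square)
    also have "\<dots> = (a*e + b*f + c*g + d*h)^2 + (a*f - b*e + c*h - d*g)^2
       + (a*g - c*e + d*f - b*h)^2 + (a*h - d*e + b*g - c*f)^2"
      by (rule euler_four_squares)
    also have "a*e + b*f + c*g + d*h = m * A"
      using r unfolding A_def e f g h by (simp add: power2_eq_square algebra_simps)
    also have "a*f - b*e + c*h - d*g = m * B"
      unfolding B_def e f g h by (simp add: algebra_simps)
    also have "a*g - c*e + d*f - b*h = m * C"
      unfolding C_def e f g h by (simp add: algebra_simps)
    also have "a*h - d*e + b*g - c*f = m * D"
      unfolding D_def e f g h by (simp add: algebra_simps)
    finally have "m^2 * (r * p) = m^2 * (A^2 + B^2 + C^2 + D^2)"
      by (simp add: power_mult_distrib algebra_simps)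
    then have "r * p = A^2 + B^2 + C^2 + D^2" using m0 by simp
    then show ?thesis unfolding sum4_def by blast
  qed
  ultimately show ?thesis using \<open>r \<le> m\<close> \<open>r \<ge> 0\<close> by (intro that) auto
qed

text \<open>For odd \<open>p\<close>, start from m p = x^2 + y^2 + 1 with 0 < m < p, the upper bound
  coming from x, y < p/2, and descend until m = 1.\<close>

lemma sum4_prime:
  fixes p :: int
  assumes p: "prime p"
  shows "sum4 p"
proof (cases "odd p")
  case False
  then have "p = 2" using p unfolding prime_int_iff by (metis numeral_eq_one_iff semiring_norm(85) zero_le_numeral)
  then have "p = 1^2 + 1^2 + 0^2 + 0^2" by simp
  then show ?thesis unfolding sum4_def by blast
next
  case True
  have desc: "0 < m \<Longrightarrow> m < p \<Longrightarrow> sum4 (m * p) \<Longrightarrow> sum4 p" for m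
  proof (induction "nat m" arbitrary: m rule: less_induct)
    case less
    show ?case
    proof (cases "m = 1")
      case True
      then show ?thesis using less by simp
    next
      case False
      then have "1 < m" using less by simp
      then obtain r where "0 < r" "r < m" "sum4 (r * p)"
        using sum4_descent[OF p] less.prems by blast
      then show ?thesis using less.hyps[of r] less.prems by simp
    qed
  qed
  obtain x y where xy: "0 \<le> x" "2 * x < p" "0 \<le> y" "2 * y < p" "p dvd x^2 + y^2 + 1"
    using prime_dvd_sum_squares_plus_1[OF p True] by blast
  obtain m where m: "x^2 + y^2 + 1 = m * p" using xy(5) by (metis dvd_def mult.commute)
  have p1: "p > 1" using p prime_gt_1_int by blast
  have "x^2 + y^2 + 1 > 0" by (smt (verit) zero_le_power2)
  then have "m > 0" using m p1 by (simp add: zero_less_mult_iff)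
  have "(2 * x)^2 \<le> (p - 1)^2" "(2 * y)^2 \<le> (p - 1)^2" using xy by (intro power_mono; simp)+
  then have "4 * x^2 \<le> p^2 - 2 * p + 1" "4 * y^2 \<le> p^2 - 2 * p + 1"
    by (simp_all add: power2_eq_square algebra_simps)
  moreover have "p^2 > 1" using p1 by (simp add: one_less_power)
  ultimately have "m * p < p * p" using m p1 unfolding power2_eq_square by linarith
  then have "m < p" using p1 by simp
  moreover have "sum4 (m * p)" unfolding sum4_def m[symmetric]
    by (metis add.right_neutral one_power2 power_zero_numeral)
  ultimately show ?thesis using desc \<open>m > 0\<close> by blast
qed

theorem sum4_nonneg:
  assumes "n \<ge> 0"
  shows "sum4 n"
  using assms
proof (induction "nat n" arbitrary: n rule: less_induct)
  case less
  consider "n = 0" | "n = 1" | "n > 1" using less.prems by linarith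
  then show ?case
  proof cases
    case 1
    then have "n = 0^2 + 0^2 + 0^2 + 0^2" by simp
    then show ?thesis unfolding sum4_def by blast
  next
    case 2
    then have "n = 1^2 + 0^2 + 0^2 + 0^2" by simp
    then show ?thesis unfolding sum4_def by blast
  next
    case 3
    then obtain p where p: "prime p" "p dvd n"
      using prime_factor_int[of n] by auto
    then obtain m where m: "n = p * m" by (elim dvdE)
    have p1: "p > 1" using p prime_gt_1_int by blast
    then have "m > 0" using m 3 by (smt (verit) zero_less_mult_pos)
    moreover from this have "m < n" using m p1 by simp
    ultimately have "sum4 m" using less.hyps[of m] by simp
    then show ?thesis using sum4_mult sum4_prime[OF p(1)] m by blast
  qed
qed

text \<open>a^2 + b^2 = 2 ((a + b)/2)^2 + 2 ((a - b)/2)^2.\<close>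

lemma two_squares_same_parity:
  fixes a b :: int
  assumes "even (a + b)"
  obtains c d where "a^2 + b^2 = 2 * c^2 + 2 * d^2"
proof -
  obtain c where c: "a + b = 2 * c" using assms by blast
  then have b: "b = 2 * c - a" by simp
  have "a^2 + b^2 = 2 * c^2 + 2 * (a - c)^2"
    unfolding b by (simp add: power2_eq_square algebra_simps)
  then show ?thesis using that by blast
qed

lemma form_1122_universal:
  fixes n :: int
  assumes "n \<ge> 0"
  obtains a b c d where "n = a^2 + b^2 + 2 * c^2 + 2 * d^2"
proof -
  obtain a b c d where n: "n = a^2 + b^2 + c^2 + d^2"
    using sum4_nonneg[OF assms] unfolding sum4_def by blast
  \<comment> \<open>Among three integers two have the same parity.\<close>
  consider "even (a + b)" | "even (b + c)" | "even (a + c)" by auto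
  then show ?thesis
  proof cases
    case 1
    then obtain e f where "a^2 + b^2 = 2 * e^2 + 2 * f^2" by (rule two_squares_same_parity)
    then show ?thesis using n by (intro that[of c d e f]) simp
  next
    case 2
    then obtain e f where "b^2 + c^2 = 2 * e^2 + 2 * f^2" by (rule two_squares_same_parity)
    then show ?thesis using n by (intro that[of a d e f]) simp
  next
    case 3
    then obtain e f where "a^2 + c^2 = 2 * e^2 + 2 * f^2" by (rule two_squares_same_parity)
    then show ?thesis using n by (intro that[of b d e f]) simp
  qed
qed


section \<open>Arithmetic of \<open>\<rat>(\<surd>2)\<close>\<close>

lemma K_I: "a \<in> \<rat> \<Longrightarrow> b \<in> \<rat> \<Longrightarrow> a + b * sqrt 2 \<in> K"
  unfolding K_def by blast

lemma K_E:
  assumes "x \<in> K"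
  obtains a b where "a \<in> \<rat>" "b \<in> \<rat>" "x = a + b * sqrt 2" "tau x = a - b * sqrt 2"
  using assms tau_eq unfolding K_def by blast

lemma Rats_subset_K: "a \<in> \<rat> \<Longrightarrow> a \<in> K"
  using K_I[of a 0] by simp

lemma sqrt2_sq: "sqrt 2 * sqrt 2 = 2" "sqrt 2 * (sqrt 2 * x) = 2 * x"
  by simp_all

lemma K_add: assumes "x \<in> K" "y \<in> K"
  shows "x + y \<in> K" "tau (x + y) = tau x + tau y"
proof -
  obtain a b where x: "a \<in> \<rat>" "b \<in> \<rat>" "x = a + b * sqrt 2" "tau x = a - b * sqrt 2"
    using assms(1) by (rule K_E)
  obtain c d where y: "c \<in> \<rat>" "d \<in> \<rat>" "y = c + d * sqrt 2" "tau y = c - d * sqrt 2"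
    using assms(2) by (rule K_E)
  have eq: "x + y = (a + c) + (b + d) * sqrt 2" using x y by (simp add: algebra_simps)
  show "x + y \<in> K" unfolding eq using x y by (intro K_I) auto
  show "tau (x + y) = tau x + tau y" unfolding eq using x y
    by (subst tau_eq) (auto simp: algebra_simps)
qed

lemma K_mult: assumes "x \<in> K" "y \<in> K"
  shows "x * y \<in> K" "tau (x * y) = tau x * tau y"
proof -
  obtain a b where x: "a \<in> \<rat>" "b \<in> \<rat>" "x = a + b * sqrt 2" "tau x = a - b * sqrt 2"
    using assms(1) by (rule K_E)
  obtain c d where y: "c \<in> \<rat>" "d \<in> \<rat>" "y = c + d * sqrt 2" "tau y = c - d * sqrt 2"
    using assms(2) by (rule K_E)
  have eq: "x * y = (a * c + 2 * b * d) + (a * d + b * c) * sqrt 2"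
    unfolding x(3) y(3) by (simp add: algebra_simps sqrt2_sq)
  show "x * y \<in> K" unfolding eq using x y by (intro K_I) auto
  have "tau (x * y) = (a * c + 2 * b * d) - (a * d + b * c) * sqrt 2"
    unfolding eq using x y by (intro tau_eq) auto
  also have "\<dots> = tau x * tau y" unfolding x(4) y(4) by (simp add: algebra_simps sqrt2_sq)
  finally show "tau (x * y) = tau x * tau y" .
qed

section \<open>Integer coordinates on Z[sqrt 2]\<close>

definition zs2 :: "int \<Rightarrow> int \<Rightarrow> real" where
  "zs2 a b = of_int a + of_int b * sqrt 2"

lemma zs2_add: "zs2 a b + zs2 c d = zs2 (a + c) (b + d)"
  by (simp add: zs2_def algebra_simps)

lemma zs2_mult: "zs2 a b * zs2 c d = zs2 (a * c + 2 * b * d) (a * d + b * c)"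
  by (simp add: zs2_def algebra_simps sqrt2_sq)

lemma tau_zs2: "tau (zs2 a b) = zs2 a (- b)"
  unfolding zs2_def by (subst tau_eq) auto

lemma zs2_eq_iff: "zs2 a b = zs2 c d \<longleftrightarrow> a = c \<and> b = d"
proof
  assume eq: "zs2 a b = zs2 c d"
  then have "zs2 a (- b) = zs2 c (- d)" unfolding tau_zs2[symmetric] by simp
  with eq have "real_of_int a = of_int c" "of_int b * sqrt 2 = of_int d * sqrt 2"
    unfolding zs2_def of_int_minus by linarith+
  then show "a = c \<and> b = d" by simp
qed simp

lemma zs2_norm: "zs2 a b * tau (zs2 a b) = of_int (a^2 - 2 * b^2)"
  unfolding tau_zs2 by (simp add: zs2_def algebra_simps power2_eq_square sqrt2_sq)

lemma zs2_in_K: "zs2 a b \<in> K"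
  unfolding zs2_def by (intro K_I) auto

lemma zs2_in_OK: "zs2 a b \<in> OK"
proof -
  \<comment> \<open>The monic polynomial whose roots are the element and its conjugate: trace 2 a,
    norm a^2 - 2 b^2.\<close>
  define p :: "real poly" where "p = [:of_int (a^2 - 2 * b^2), of_int (- 2 * a), 1:]"
  have "lead_coeff p = 1" by (simp add: p_def)
  moreover have "\<forall>i. coeff p i \<in> \<int>"
    unfolding p_def by (simp add: coeff_pCons split: nat.split)
  moreover have "poly p (zs2 a b) = 0"
    by (simp add: p_def zs2_def algebra_simps power2_eq_square sqrt2_sq)
  ultimately have "algebraic_int (zs2 a b)" by (rule algebraic_int.intros)
  then show ?thesis unfolding OK_def using zs2_in_K by blast
qed

definition Zsqrt2 :: "real set" where
  "Zsqrt2 = range (case_prod zs2)"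

lemma zs2_in_Zsqrt2: "zs2 a b \<in> Zsqrt2"
  unfolding Zsqrt2_def by (metis case_prod_conv rangeI)

lemma Zsqrt2_E:
  assumes "x \<in> Zsqrt2"
  obtains a b where "x = zs2 a b"
  using assms unfolding Zsqrt2_def by auto

lemma Zsqrt2_add: "x \<in> Zsqrt2 \<Longrightarrow> y \<in> Zsqrt2 \<Longrightarrow> x + y \<in> Zsqrt2"
  by (metis Zsqrt2_E zs2_add zs2_in_Zsqrt2)

lemma Zsqrt2_mult: "x \<in> Zsqrt2 \<Longrightarrow> y \<in> Zsqrt2 \<Longrightarrow> x * y \<in> Zsqrt2"
  by (metis Zsqrt2_E zs2_mult zs2_in_Zsqrt2)

lemma Ints_subset_Zsqrt2: "x \<in> \<int> \<Longrightarrow> x \<in> Zsqrt2"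
  using zs2_in_Zsqrt2[of _ 0] by (auto simp: zs2_def elim: Ints_cases)

lemma Zsqrt2_power: "x \<in> Zsqrt2 \<Longrightarrow> x ^ n \<in> Zsqrt2"
  using Ints_subset_Zsqrt2[of 1] by (induction n) (auto intro: Zsqrt2_mult)

lemma Zsqrt2_sum: "(\<And>i. i \<in> A \<Longrightarrow> f i \<in> Zsqrt2) \<Longrightarrow> sum f A \<in> Zsqrt2"
  using Ints_subset_Zsqrt2[of 0]
  by (induction A rule: infinite_finite_induct) (auto intro: Zsqrt2_add)

section \<open>The ring of integers of the field\<close>

lemma K_denominator:
  assumes "x \<in> K"
  obtains w :: int where "w \<noteq> 0" "of_int w * x \<in> Zsqrt2"
proof -
  obtain a b where x: "a \<in> \<rat>" "b \<in> \<rat>" "x = a + b * sqrt 2" using assms by (rule K_E)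
  obtain p q :: int where a: "q \<noteq> 0" "a = of_int p / of_int q"
    using x(1) by (metis Rats_cases' less_irrefl)
  obtain r s :: int where b: "s \<noteq> 0" "b = of_int r / of_int s"
    using x(2) by (metis Rats_cases' less_irrefl)
  have "of_int (q * s) * x = zs2 (p * s) (r * q)"
    unfolding x(3) zs2_def a(2) b(2) using a(1) b(1) by (simp add: field_simps)
  then show ?thesis using a b zs2_in_Zsqrt2 by (intro that[of "q * s"]) auto
qed

text \<open>If \<open>w\<close> clears the denominator of \<open>x\<close> and the monic equation
  has degree n, then w^n clears those of x^k for k < n, and the equation reduces higher powers to
  lower ones with integer coefficients.\<close>

lemma algebraic_int_powers_bounded_denominator:
  assumes "x \<in> K" "algebraic_int x"
  obtains W :: int where "W \<noteq> 0" "\<And>k. of_int W * x ^ k \<in> Zsqrt2"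
proof -
  obtain p where p: "lead_coeff p = 1" "\<forall>i. coeff p i \<in> \<int>" "poly p x = 0"
    using assms(2) unfolding algebraic_int.simps by blast
  obtain w :: int where w: "w \<noteq> 0" "of_int w * x \<in> Zsqrt2" using K_denominator[OF assms(1)] by blast
  define n where "n = degree p"
  have xn: "x ^ n = (\<Sum>i<n. - coeff p i * x ^ i)"
  proof -
    have "0 = (\<Sum>i\<le>n. coeff p i * x ^ i)" using p(3) by (simp add: poly_altdef n_def)
    also have "\<dots> = (\<Sum>i<n. coeff p i * x ^ i) + x ^ n"
      using p(1) by (simp add: n_def flip: lessThan_Suc_atMost)
    finally show ?thesis by (simp add: sum_negf)
  qed
  have "of_int (w ^ n) * x ^ k \<in> Zsqrt2" for k
  proof (induction k rule: less_induct)
    case (less k)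
    show ?case
    proof (cases "k < n")
      case True
      then have "of_int (w ^ n) * x ^ k = of_int (w ^ (n - k)) * (of_int w * x) ^ k"
        by (simp add: power_mult_distrib flip: power_add)
      then show ?thesis using w by (simp del: of_int_power add: Zsqrt2_mult Zsqrt2_power Ints_subset_Zsqrt2)
    next
      case False
      have "of_int (w ^ n) * x ^ k = of_int (w ^ n) * (x ^ (k - n) * x ^ n)"
        using False by (simp flip: power_add)
      also have "\<dots> = (\<Sum>i<n. - coeff p i * (of_int (w ^ n) * x ^ (k - n + i)))"
        unfolding xn by (simp add: sum_distrib_left power_add algebra_simps)
      also have "\<dots> \<in> Zsqrt2"
      proof (rule Zsqrt2_sum, rule Zsqrt2_mult[OF Ints_subset_Zsqrt2])
        show "- coeff p i \<in> \<int>" for i using p(2) by simp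
        show "of_int (w ^ n) * x ^ (k - n + i) \<in> Zsqrt2" if "i \<in> {..<n}" for i
          using that False by (intro less) auto
      qed
      finally show ?thesis .
    qed
  qed
  then show ?thesis using w by (intro that[of "w ^ n"]) auto
qed

text \<open>Euclidean division: subtracting from \<open>x\<close> a nearest element of \<open>\<int>[\<surd>2]\<close> leaves a remainder of
  norm less than 1. Its powers have bounded denominators and norms tending to 0, so it vanishes.\<close>

lemma OK_eq_Zsqrt2: "OK = Zsqrt2"
proof
  show "Zsqrt2 \<subseteq> OK" using zs2_in_OK by (auto elim: Zsqrt2_E)
  show "OK \<subseteq> Zsqrt2"
  proof
    fix x assume "x \<in> OK"
    then have x: "x \<in> K" "algebraic_int x" by (auto simp: OK_def)
    obtain a b where ab: "a \<in> \<rat>" "b \<in> \<rat>" "x = a + b * sqrt 2" using x(1) by (rule K_E)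
    obtain W :: int where W: "W \<noteq> 0" "\<And>k. of_int W * x ^ k \<in> Zsqrt2"
      using algebraic_int_powers_bounded_denominator[OF x] by blast
    define c d where "c = a - of_int (round a)" and "d = b - of_int (round b)"
    define q where "q = zs2 (round a) (round b)"
    define y where "y = c + d * sqrt 2"
    have cd: "c \<in> \<rat>" "d \<in> \<rat>" using ab by (auto simp: c_def d_def)
    have xy: "x = y + q" by (simp add: y_def q_def zs2_def ab c_def d_def algebra_simps)
    have yK: "y \<in> K" unfolding y_def using cd by (rule K_I)
    have tau_y: "tau y = c - d * sqrt 2" unfolding y_def using cd by (rule tau_eq)
    have "\<bar>c\<bar> \<le> 1 / 2" "\<bar>d\<bar> \<le> 1 / 2"
      unfolding c_def d_def using of_int_round_abs_le by (metis abs_minus_commute)+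
    then have "c^2 \<le> 1 / 4" "d^2 \<le> 1 / 4"
      using power_mono[of "\<bar>c\<bar>" "1 / 2" 2] power_mono[of "\<bar>d\<bar>" "1 / 2" 2]
      by (simp_all add: power2_eq_square)
    moreover have N: "y * tau y = c^2 - 2 * d^2"
      unfolding tau_y unfolding y_def by (simp add: algebra_simps power2_eq_square sqrt2_sq)
    ultimately have small: "\<bar>y * tau y\<bar> \<le> 1 / 2"
      using zero_le_power2[of c] zero_le_power2[of d] by linarith
    have Wy: "of_int W * y ^ k \<in> Zsqrt2" for k
    proof -
      have "of_int W * y ^ k = of_int W * (x + (- q)) ^ k" using xy by simp
      also have "\<dots> = (\<Sum>i\<le>k. of_nat (k choose i) * (of_int W * x ^ i) * (- q) ^ (k - i))"
        unfolding binomial_ring by (simp add: sum_distrib_left mult_ac)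
      also have "- q = zs2 (- round a) (- round b)" by (simp add: q_def zs2_def)
      also have "(\<Sum>i\<le>k. of_nat (k choose i) * (of_int W * x ^ i) * zs2 (- round a) (- round b) ^ (k - i)) \<in> Zsqrt2"
        by (intro Zsqrt2_sum Zsqrt2_mult W Zsqrt2_power zs2_in_Zsqrt2 Ints_subset_Zsqrt2) auto
      finally show ?thesis .
    qed
    have tau_pow: "y ^ k \<in> K \<and> tau (y ^ k) = tau y ^ k" for k
    proof (induction k)
      case 0
      show ?case using Rats_subset_K[of 1] tau_eq[of 1 0] by simp
    qed (simp add: K_mult yK)
    \<comment> \<open>This is the norm of W y^k, an element of Z[sqrt 2], because \<open>tau\<close>
      fixes \<open>W\<close>.\<close>
    have N_int: "of_int W ^ 2 * (y * tau y) ^ k \<in> \<int>" for k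
    proof -
      have WK: "of_int W \<in> K" "tau (of_int W) = of_int W"
        using Rats_subset_K[of "of_int W"] tau_eq[of "of_int W" 0] by auto
      obtain A B where AB: "of_int W * y ^ k = zs2 A B" using Wy by (rule Zsqrt2_E)
      have "of_int W ^ 2 * (y * tau y) ^ k = (of_int W * y ^ k) * tau (of_int W * y ^ k)"
        using K_mult(2)[of "of_int W" "y ^ k"] WK tau_pow[of k]
        by (simp add: power_mult_distrib power2_eq_square)
      also have "\<dots> \<in> \<int>" unfolding AB zs2_norm by simp
      finally show ?thesis .
    qed
    have "y * tau y = 0"
    proof (rule ccontr)
      assume nz: "y * tau y \<noteq> 0"
      obtain k where k: "(1 / 2) ^ k < 1 / (of_int W ^ 2 :: real)"
        using real_arch_pow_inv[of "1 / of_int W ^ 2" "1 / 2"] W(1) by auto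
      have "\<bar>of_int W ^ 2 * (y * tau y) ^ k\<bar> = of_int W ^ 2 * \<bar>y * tau y\<bar> ^ k"
        by (simp add: abs_mult power_abs)
      also have "\<dots> \<le> of_int W ^ 2 * (1 / 2) ^ k"
        using small by (intro mult_left_mono power_mono) auto
      also have "\<dots> < 1" using k W(1) by (simp add: field_simps)
      finally have "of_int W ^ 2 * (y * tau y) ^ k = 0"
        using N_int[of k] Ints_nonzero_abs_less1 by blast
      then show False using nz W(1) by simp
    qed
    then have "c + d * sqrt 2 = 0 \<or> c + (- d) * sqrt 2 = 0" unfolding tau_y unfolding y_def by simp
    \<comment> \<open>If one of the two conjugates is zero, applying \<open>tau\<close> shows that
      the other is zero too.\<close>
    then have "c = 0 \<and> d = 0"
      using tau_eq[OF cd] tau_eq[of c "- d"] tau_eq[of 0 0] cd by auto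
    then show "x \<in> Zsqrt2" using xy zs2_in_Zsqrt2 by (simp add: y_def q_def)
  qed
qed

lemma OK_E:
  assumes "x \<in> OK"
  obtains a b where "x = zs2 a b"
  using assms Zsqrt2_E unfolding OK_eq_Zsqrt2 by blast

lemmas OK_add = Zsqrt2_add[folded OK_eq_Zsqrt2]
  and OK_mult = Zsqrt2_mult[folded OK_eq_Zsqrt2]
  and OK_power = Zsqrt2_power[folded OK_eq_Zsqrt2]

lemma OK_of_int: "of_int a \<in> OK"
  using zs2_in_OK[of a 0] by (simp add: zs2_def)

lemma eps_zs2: "eps = zs2 3 2" and beta_zs2: "beta = zs2 2 1"
  by (simp_all add: eps_def beta_def zs2_def)

lemma eps_beta_in_OK: "eps \<in> OK" "beta \<in> OK"
  unfolding eps_zs2 beta_zs2 by (rule zs2_in_OK)+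

lemma OK_subset_K: "OK \<subseteq> K"
  by (auto simp: OK_def)

text \<open>The trace 2 m and the norm m^2 - 2 n^2 of a totally positive element are
  positive.\<close>

lemma OK_pos_E:
  assumes "\<alpha> \<in> OK_pos"
  obtains m n where "\<alpha> = zs2 m n" "m > 0" "m^2 > 2 * n^2"
proof -
  obtain m n where mn: "\<alpha> = zs2 m n" using assms OK_E by (auto simp: OK_pos_def)
  have pos: "zs2 m n > 0" "zs2 m (- n) > 0"
    using assms by (auto simp: OK_pos_def totally_pos_def mn tau_zs2)
  then have "m > 0" by (simp add: zs2_def)
  moreover have "real_of_int m ^ 2 - 2 * real_of_int n ^ 2 = zs2 m n * zs2 m (- n)"
    by (simp add: zs2_def algebra_simps power2_eq_square sqrt2_sq)
  then have "real_of_int m ^ 2 > 2 * real_of_int n ^ 2" using pos by (smt (verit) mult_pos_pos)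
  then have "real_of_int (m^2) > real_of_int (2 * n^2)" by simp
  then have "m^2 > 2 * n^2" by (simp only: of_int_less_iff)
  ultimately show ?thesis using mn that by blast
qed


section \<open>The coefficients of the form\<close>

lemma x_sq_coeff: "x_sq k i j = (if i = j \<and> i = 2 * k then 1 else 0)"
  by (simp add: x_sq_def lin_sq_def zv_def)

lemma g_coeff_0: "i < 2 * k \<Longrightarrow> g k i j = 0"
  by (auto simp: g_def lin_sq_def zv_def tzv_def)

text \<open>Indices 0 to 7 stand for x_1, ..., x_4 and their conjugates, which share no monomial
  with the z variables.\<close>

lemma form12_coeff_x:
  assumes "i < 8"
  shows "gcoeff form12 i j = (if i = j \<and> even i then 1 else 0)"
proof -
  have "i \<in> {0,1,2,3,4,5,6,7}" using assms by auto
  then show ?thesis using assms by (auto simp: form12_def g_coeff_0 x_sq_coeff)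
qed

lemma eps_pos: "eps > 0" and beta_pos: "beta > 0"
  by (simp_all add: eps_def beta_def add_pos_pos)

text \<open>The expansion of g(z) contains 4 z^2 and tau(z)^2, and its factor is positive. These
  diagonal coefficients make z proper, in \<open>form12\<close> and in every subform that keeps
  z.\<close>

lemma form12_coeff_g:
  assumes "4 \<le> k" "k < 12"
  shows "gcoeff form12 (2 * k) (2 * k) \<noteq> 0" "gcoeff form12 (2 * k + 1) (2 * k + 1) \<noteq> 0"
proof -
  have "k \<in> {4,5,6,7,8,9,10,11}" using assms by auto
  then show "gcoeff form12 (2 * k) (2 * k) \<noteq> 0" "gcoeff form12 (2 * k + 1) (2 * k + 1) \<noteq> 0"
    using eps_pos beta_pos
    by (auto simp: form12_def x_sq_def g_def lin_sq_def zv_def tzv_def)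
qed

lemma lin_sq_in_OK:
  assumes "\<And>i. l i \<in> OK"
  shows "lin_sq l i j \<in> OK"
  using assms OK_of_int[of 0] OK_of_int[of 2]
  by (auto simp: lin_sq_def power2_eq_square intro!: OK_mult)

lemma form12_integral: "gf_integral form12"
proof -
  have z: "zv k i \<in> OK" for k i using OK_of_int[of 0] OK_of_int[of 1] by (auto simp: zv_def)
  have l: "2 * zv k i - tzv k i \<in> OK" for k i
    using OK_of_int[of 0] OK_of_int[of 2] OK_of_int[of "-1"] by (auto simp: zv_def tzv_def)
  have x: "x_sq k i j \<in> OK" for k i j unfolding x_sq_def by (intro lin_sq_in_OK z)
  have g: "g k i j \<in> OK" for k i j unfolding g_def by (intro lin_sq_in_OK l)
  have "gcoeff form12 i j \<in> OK" for i j
    unfolding form12_def gform.sel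
    by (intro OK_add OK_mult OK_power x g eps_beta_in_OK)
  moreover have "gcoeff form12 i j = 0" if "\<not> (i \<le> j \<and> j < 24)" for i j
  proof -
    have "x_sq k i j = 0" "g k i j = 0" if "k < 12" for k
      using that \<open>\<not> (i \<le> j \<and> j < 24)\<close>
      by (auto simp: x_sq_def g_def lin_sq_def zv_def tzv_def)
    then show ?thesis by (simp add: form12_def)
  qed
  moreover have "gvars form12 = 12" by (simp add: form12_def)
  ultimately show ?thesis by (auto simp: gf_integral_def qf_over_def G0_def)
qed

lemma form12_over_K: "gf_over_K form12"
  using form12_integral OK_subset_K
  by (auto simp: gf_integral_def gf_over_K_def qf_over_def split: if_splits)


section \<open>Semidefiniteness\<close>

lemma gvars_form12: "gvars form12 = 12"
  by (simp add: form12_def)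

lemma not_tau_appears: "k < 4 \<Longrightarrow> \<not> tau_z_appears form12 k"
proof
  assume k: "k < 4" and "tau_z_appears form12 k"
  then obtain i j where ij: "i \<le> j" "gcoeff form12 i j \<noteq> 0" "2 * k + 1 = i \<or> 2 * k + 1 = j"
    unfolding tau_z_appears_def qf_appears_def G0_def by auto
  then have "i < 8" using k by auto
  then have "i = j" "even i" using ij(2) form12_coeff_x[of i j] by (auto split: if_splits)
  with ij(3) show False by auto
qed

lemma proper_var_if_diagonal:
  assumes "k < gvars G" "gcoeff G (2 * k) (2 * k) \<noteq> 0" "gcoeff G (2 * k + 1) (2 * k + 1) \<noteq> 0"
  shows "proper_var G k"
proof -
  have "2 * k < 2 * gvars G" "2 * k + 1 < 2 * gvars G" using assms(1) by simp_all
  then show ?thesis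
    using assms(2,3) unfolding proper_var_def z_appears_def tau_z_appears_def qf_appears_def G0_def qform.sel
    by blast
qed

lemma proper_var_form12: "4 \<le> k \<Longrightarrow> k < 12 \<Longrightarrow> proper_var form12 k"
  by (intro proper_var_if_diagonal form12_coeff_g) (auto simp: gvars_form12)

text \<open>The x variables enter without their conjugates, each proper z variable with its
  conjugate: 4 + 16 = 20 variables.\<close>

lemma assoc_vars_form12: "assoc_vars form12 = [0, 2, 4, 6] @ [8..<24]"
proof -
  have p: "proper_var form12 k \<longleftrightarrow> 4 \<le> k" if "k < 12" for k
    using that proper_var_form12 not_tau_appears[of k] by (cases "4 \<le> k") (auto simp: proper_var_def)
  have "[0..<12] = [0, 1, 2, 3, 4, 5, 6, 7, 8, 9, 10, 11 :: nat]"
    by (simp add: upt_rec)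
  then show ?thesis
    by (simp add: assoc_vars_def gvars_form12 p not_tau_appears upt_rec)
qed

lemma tau_nonneg_simps: "totally_nonneg eps" "totally_nonneg beta"
proof -
  have "sqrt 2 < 3 / 2" by (rule real_less_lsqrt) (auto simp: power2_eq_square)
  then show "totally_nonneg eps" "totally_nonneg beta"
    unfolding totally_nonneg_def eps_zs2 beta_zs2 tau_zs2 by (simp_all add: zs2_def)
qed

text \<open>A set closed under sums and products that contains all squares of \<open>K\<close>,
  \<open>eps\<close> and \<open>beta\<close>; membership in \<open>K\<close> is included because
  \<open>tau\<close> respects the operations there.\<close>

definition K_nonneg :: "real set" where
  "K_nonneg = {x \<in> K. totally_nonneg x}"

lemma K_nonneg_add: "x \<in> K_nonneg \<Longrightarrow> y \<in> K_nonneg \<Longrightarrow> x + y \<in> K_nonneg"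
  by (auto simp: K_nonneg_def totally_nonneg_def K_add)

lemma K_nonneg_mult: "x \<in> K_nonneg \<Longrightarrow> y \<in> K_nonneg \<Longrightarrow> x * y \<in> K_nonneg"
  by (auto simp: K_nonneg_def totally_nonneg_def K_mult)

lemma K_nonneg_sq: "x \<in> K \<Longrightarrow> x^2 \<in> K_nonneg"
  by (auto simp: K_nonneg_def totally_nonneg_def K_mult power2_eq_square)

lemma K_nonneg_power: "x \<in> K_nonneg \<Longrightarrow> x ^ n \<in> K_nonneg"
  using K_nonneg_sq[of 1] Rats_subset_K[of 1]
  by (induction n) (auto intro: K_nonneg_mult)

lemma K_nonneg_eps_beta: "eps \<in> K_nonneg" "beta \<in> K_nonneg"
  using tau_nonneg_simps eps_beta_in_OK OK_subset_K by (auto simp: K_nonneg_def)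

lemma K_sum: "(\<And>i. i \<in> A \<Longrightarrow> f i \<in> K) \<Longrightarrow> sum f A \<in> K"
  using Rats_subset_K[of 0] by (induction A rule: infinite_finite_induct) (auto intro: K_add)

text \<open>In the variables of the associated form, each x_k^2 and each g(z_k) is the square of a
  linear form with rational coefficients, and the weights are products of powers of
  \<open>eps\<close> and \<open>beta\<close>, which are totally nonnegative.\<close>

lemma form12_semidef: "gf_totally_pos_semidef form12"
  unfolding gf_totally_pos_semidef_def qf_totally_pos_semidef_def
proof (intro allI impI)
  fix x assume x: "(\<forall>i<qvars (assoc_qform form12). x i \<in> K) \<and> (\<exists>i<qvars (assoc_qform form12). x i \<noteq> 0)"
  define vs :: "nat list" where "vs = [0, 2, 4, 6] @ [8..<24]"
  have len: "length vs = 20" by (simp add: vs_def)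
  have "sorted_wrt (<) vs" by (simp add: vs_def upt_rec)
  then have vs: "vs ! i < vs ! j" if "i < j" "j < 20" for i j
    using that len by (simp add: sorted_wrt_nth_less)
  \<comment> \<open>As \<open>vs\<close> is strictly increasing, renumbering by it respects the
    diagonal and the upper triangle, so squares of linear forms pull back to squares of linear
    forms.\<close>
  have lin: "lin_sq l (vs ! i) (vs ! j) = lin_sq (\<lambda>i. l (vs ! i)) i j" if "i \<le> j" "j < 20" for i j l
    using vs[of i j] that by (cases "i = j") (auto simp: lin_sq_def)
  have aq: "assoc_qform form12 = QForm 20 (\<lambda>i j. if i \<le> j \<and> j < 20
      then monom_coeff (G0 form12) (vs ! i) (vs ! j) else 0)"
    using len unfolding assoc_qform_def assoc_vars_form12 vs_def[symmetric] Let_def by simp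
  have xK: "x i \<in> K" if "i < 20" for i using x that unfolding aq by simp
  define E where "E = (\<lambda>c. qf_eval (QForm 20 c) x)"
  have add: "E (\<lambda>i j. a i j + b i j) = E a + E b" for a b
    by (simp add: E_def qf_eval_def sum.distrib algebra_simps)
  have scale: "E (\<lambda>i j. c * a i j) = c * E a" for c a
    by (simp add: E_def qf_eval_def sum_distrib_left mult.assoc)
  define X where "X = (\<lambda>k. lin_sq (\<lambda>i. zv k (vs ! i)))"
  define Y where "Y = (\<lambda>k. lin_sq (\<lambda>i. 2 * zv k (vs ! i) - tzv k (vs ! i)))"
  have "(\<Sum>i<20. l i * x i) ^ 2 \<in> K_nonneg" if "\<And>i. l i \<in> \<rat>" for l
    using that by (intro K_nonneg_sq K_sum K_mult Rats_subset_K xK) auto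
  then have lsq: "E (lin_sq l) \<in> K_nonneg" if "\<And>i. l i \<in> \<rat>" for l
    using that by (simp add: E_def lin_sq_eval)
  have EX: "E (X k) \<in> K_nonneg" for k
    unfolding X_def by (rule lsq) (auto simp: zv_def)
  have EY: "E (Y k) \<in> K_nonneg" for k
    unfolding Y_def by (rule lsq) (auto simp: zv_def tzv_def)
  have "qf_eval (assoc_qform form12) x = E (\<lambda>i j.
     X 0 i j + X 1 i j + X 2 i j + X 3 i j
     + Y 4 i j + eps * Y 5 i j + eps ^ 2 * Y 6 i j + eps ^ 3 * Y 7 i j
     + beta * Y 8 i j + eps * beta * Y 9 i j + eps ^ 2 * beta * Y 10 i j
     + eps ^ 3 * beta * Y 11 i j)"
    unfolding E_def qf_eval_def aq qform.sel
  proof (intro sum.cong refl arg_cong[of _ _ "\<lambda>c. c * _ * _"])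
    fix i j :: nat assume "i \<in> {..<20}" "j \<in> {i..<20}"
    then have ij: "i \<le> j" "j < 20" by auto
    then have "vs ! i \<le> vs ! j" using vs[of i j] by (cases "i = j") auto
    then have "monom_coeff (G0 form12) (vs ! i) (vs ! j) = gcoeff form12 (vs ! i) (vs ! j)"
      by (simp add: monom_coeff_def G0_def)
    then show "(if i \<le> j \<and> j < 20 then monom_coeff (G0 form12) (vs ! i) (vs ! j) else 0) =
     X 0 i j + X 1 i j + X 2 i j + X 3 i j
     + Y 4 i j + eps * Y 5 i j + eps ^ 2 * Y 6 i j + eps ^ 3 * Y 7 i j
     + beta * Y 8 i j + eps * beta * Y 9 i j + eps ^ 2 * beta * Y 10 i j
     + eps ^ 3 * beta * Y 11 i j"
      using ij by (simp add: form12_def X_def Y_def x_sq_def g_def lin)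
  qed
  also have "\<dots> \<in> K_nonneg"
    unfolding add scale
    by (intro K_nonneg_add K_nonneg_mult K_nonneg_power K_nonneg_eps_beta EX EY)
  finally show "totally_nonneg (qf_eval (assoc_qform form12) x)" by (simp add: K_nonneg_def)
qed


section \<open>Universality\<close>

text \<open>As \<open>z\<close> runs over \<open>\<int>[\<surd>2]\<close>, \<open>2 z - \<tau>(z)\<close> runs over all \<open>a + 3 b \<surd>2\<close>; this set is
  stable under \<open>\<epsilon>\<^sup>2 = 17 + 12 \<surd>2\<close> and its inverse.\<close>

lemma g_mult_eps2:
  assumes "z \<in> OK"
  obtains w where "w \<in> OK" "2 * w - tau w = zs2 17 12 * (2 * z - tau z)"
proof -
  obtain a b where z: "z = zs2 a b" using assms by (rule OK_E)
  \<comment> \<open>(17 + 12 sqrt 2) (a + 3 b sqrt 2) = (17 a + 72 b) + 3 (4 a + 17 b) sqrt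
    2.\<close>
  show ?thesis
    by (rule that[of "zs2 (17 * a + 72 * b) (4 * a + 17 * b)"])
      (auto simp: zs2_in_OK z tau_zs2, auto simp: zs2_def algebra_simps sqrt2_sq)
qed

lemma g_div_eps2:
  assumes "z \<in> OK"
  obtains w where "w \<in> OK" "2 * w - tau w = zs2 17 (-12) * (2 * z - tau z)"
proof -
  obtain a b where z: "z = zs2 a b" using assms by (rule OK_E)
  show ?thesis
    by (rule that[of "zs2 (17 * a - 72 * b) (17 * b - 4 * a)"])
      (auto simp: zs2_in_OK z tau_zs2, auto simp: zs2_def algebra_simps sqrt2_sq)
qed

text \<open>A cyclic shift: the x variables are multiplied by 1 + sqrt 2, whose square is
  \<open>eps\<close>, and each z variable moves to the next power of \<open>eps\<close>. At the end
  of a chain, \<open>eps ^ 4\<close> is the square of 17 + 12 sqrt 2 and is absorbed by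
  \<open>g_mult_eps2\<close>.\<close>

lemma represents_mult_eps:
  assumes "represents form12 \<alpha>"
  shows "represents form12 (zs2 3 2 * \<alpha>)"
proof -
  obtain z where z: "\<forall>k<12. z k \<in> OK" "gf_eval form12 z = \<alpha>"
    using assms by (auto simp: represents_def gvars_form12)
  obtain u where u: "u \<in> OK" "2 * u - tau u = zs2 17 12 * (2 * z 7 - tau (z 7))"
    using g_mult_eps2[of "z 7"] z(1) by auto
  obtain v where v: "v \<in> OK" "2 * v - tau v = zs2 17 12 * (2 * z 11 - tau (z 11))"
    using g_mult_eps2[of "z 11"] z(1) by auto
  define w where "w = (\<lambda>k::nat. if k < 4 then zs2 1 1 * z k else if k = 4 then u
    else if k = 8 then v else z (k - 1))"
  have "\<forall>k<12. w k \<in> OK"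
    using z(1) u v by (auto simp: w_def intro!: OK_mult zs2_in_OK)
  moreover have "gf_eval form12 w = zs2 3 2 * \<alpha>"
  proof -
    have e: "zs2 1 1 ^ 2 = eps" "zs2 17 12 ^ 2 = eps * eps ^ 3" "zs2 3 2 = eps"
      by (simp_all add: eps_zs2 power2_eq_square power3_eq_cube zs2_mult)
    show ?thesis unfolding z(2)[symmetric] form12_eval
      by (simp add: w_def u(2) v(2) power_mult_distrib e)
        (simp add: algebra_simps power2_eq_square power3_eq_cube)
  qed
  ultimately show ?thesis by (auto simp: represents_def gvars_form12)
qed

text \<open>The reverse shift, with -1 + sqrt 2 = 1/(1 + sqrt 2) on the x variables. The first z
  variable of each chain wraps round to weight \<open>eps ^ 3\<close>, its linear form being
  multiplied by eps^(-2) = 17 - 12 sqrt 2.\<close>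

lemma represents_div_eps:
  assumes "represents form12 \<alpha>"
  shows "represents form12 (zs2 3 (-2) * \<alpha>)"
proof -
  obtain z where z: "\<forall>k<12. z k \<in> OK" "gf_eval form12 z = \<alpha>"
    using assms by (auto simp: represents_def gvars_form12)
  obtain u where u: "u \<in> OK" "2 * u - tau u = zs2 17 (-12) * (2 * z 4 - tau (z 4))"
    using g_div_eps2[of "z 4"] z(1) by auto
  obtain v where v: "v \<in> OK" "2 * v - tau v = zs2 17 (-12) * (2 * z 8 - tau (z 8))"
    using g_div_eps2[of "z 8"] z(1) by auto
  define w where "w = (\<lambda>k::nat. if k < 4 then zs2 (-1) 1 * z k else if k = 7 then u
    else if k = 11 then v else z (k + 1))"
  define \<delta> where "\<delta> = zs2 3 (-2)"
  have "\<forall>k<12. w k \<in> OK"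
    using z(1) u v by (auto simp: w_def intro!: OK_mult zs2_in_OK)
  moreover have "gf_eval form12 w = \<delta> * \<alpha>"
  proof -
    have e: "zs2 (-1) 1 ^ 2 = \<delta>" "zs2 17 (-12) ^ 2 = \<delta> ^ 4"
      by (simp_all add: \<delta>_def power2_eq_square power4_eq_xxxx zs2_mult)
    have "\<delta> * eps = 1"
      by (simp add: \<delta>_def eps_zs2 zs2_mult) (simp add: zs2_def)
    then have d: "\<delta> * (eps * x) = x" "eps * (\<delta> * x) = x" for x
      by (metis mult.assoc mult.commute mult_1)+
    show ?thesis unfolding z(2)[symmetric] form12_eval
      by (simp add: w_def u(2) v(2) power_mult_distrib e)
        (simp add: algebra_simps power2_eq_square power3_eq_cube power4_eq_xxxx d)
  qed
  ultimately show ?thesis by (auto simp: represents_def gvars_form12 \<delta>_def)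
qed

text \<open>
  The squares \<open>1\<close>, \<open>2\<close>, \<open>\<epsilon> = (1 + \<surd>2)\<^sup>2\<close>, \<open>2 \<epsilon> = (2 + \<surd>2)\<^sup>2\<close> are each available twice: once
  through an \<open>x\<^sub>i\<close> and once through one of \<open>z\<^sub>1, \<dots>, z\<^sub>4\<close>, because every element of \<open>\<int>[\<surd>2]\<close>
  lies modulo \<open>3\<close> on one of the four lines \<open>(1 + \<surd>2)\<^sup>i \<int>\<close>. So the coefficients of \<open>1\<close> and of
  \<open>\<epsilon>\<close> both range over the values of \<open>a\<^sup>2 + b\<^sup>2 + 2 c\<^sup>2 + 2 d\<^sup>2\<close>.
\<close>

lemma represents_cone:
  fixes c d e :: int
  assumes "c \<ge> 0" "d \<ge> 0" "e \<in> {0, 1}"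
  shows "represents form12 (of_int c + of_int d * eps + of_int e * beta)"
proof -
  obtain p u q u' where c: "c = p^2 + u^2 + 2 * q^2 + 2 * u'^2"
    using form_1122_universal[OF assms(1)] by blast
  obtain r v t v' where d: "d = r^2 + v^2 + 2 * t^2 + 2 * v'^2"
    using form_1122_universal[OF assms(2)] by blast
  \<comment> \<open>For z = -4 + sqrt 2 the value 2 z - tau(z) is -4 + 3 sqrt 2 = sqrt 2 / eps, so
    g(z) = 2 / eps^2; the weights \<open>eps ^ 2\<close> and \<open>eps ^ 3\<close> turn this into 2
    and 2 eps. For \<open>e\<close>, e^2 = e.\<close>
  define zs where "zs = [zs2 u 0, zs2 0 u', zs2 v v, zs2 (2 * v') v',
    zs2 p 0, zs2 r 0, zs2 (-4 * q) q, zs2 (-4 * t) t, zs2 e 0, zs2 0 0, zs2 0 0, zs2 0 0]"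
  have "set zs \<subseteq> OK" "length zs = 12" by (auto simp: zs_def zs2_in_OK)
  then have "\<forall>k<12. zs ! k \<in> OK" by (metis nth_mem subsetD)
  moreover have "gf_eval form12 ((!) zs) = of_int c + of_int d * eps + of_int e * beta"
    unfolding form12_eval using assms(3)
    by (auto simp: zs_def tau_zs2 c d)
      (simp_all add: zs2_def eps_def beta_def power2_eq_square power3_eq_cube algebra_simps sqrt2_sq)
  ultimately show ?thesis unfolding represents_def gvars_form12 by blast
qed

text \<open>The map sending x to eps tau(x) exchanges 1 and \<open>eps\<close> and fixes
  \<open>beta\<close>. Hence the second claim uses the decomposition of the first with the
  coefficients of 1 and \<open>eps\<close> exchanged.\<close>

lemma represents_cone_zs2:
  assumes "m \<ge> 2 * n" "n \<ge> 0"
  shows "represents form12 (zs2 m n)" "represents form12 (zs2 (3 * m - 4 * n) (2 * m - 3 * n))"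
proof -
  define d r where "d = n div 2" and "r = n mod 2"
  have n: "n = 2 * d + r" and r: "r \<in> {0, 1}" by (auto simp: d_def r_def)
  have pos: "d \<ge> 0" "m - 2 * n + d \<ge> 0" using assms by (auto simp: d_def)
  have "zs2 m n = of_int (m - 2 * n + d) + of_int d * eps + of_int r * beta"
    unfolding n by (simp add: zs2_def eps_def beta_def algebra_simps)
  then show "represents form12 (zs2 m n)" using represents_cone[OF pos(2,1) r] by simp
  have "zs2 (3 * m - 4 * n) (2 * m - 3 * n) = of_int d + of_int (m - 2 * n + d) * eps + of_int r * beta"
    unfolding n by (simp add: zs2_def eps_def beta_def algebra_simps)
  then show "represents form12 (zs2 (3 * m - 4 * n) (2 * m - 3 * n))"
    using represents_cone[OF pos r] by simp
qed

text \<open>Induction on the rational part. If m >= 2 |n|, the element (for n >= 0) or its product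
  with \<open>eps\<close> (for n < 0) is covered by \<open>represents_cone_zs2\<close>; otherwise
  multiplication by \<open>eps\<close> or its inverse lowers the rational part.\<close>

lemma represents_zs2:
  assumes "m > 0" "m^2 > 2 * n^2"
  shows "represents form12 (zs2 m n)"
  using assms
proof (induction "nat m" arbitrary: m n rule: less_induct)
  case less
  \<comment> \<open>The two elements are (m + k sqrt 2)/eps and eps (m - k sqrt 2). Their norm is
    m^2 - 2 k^2; their rational part 3 m - 4 k is below m because m < 2 k, and positive because 16
    k^2 <= 18 k^2 < 9 m^2.\<close>
  have step: "represents form12 (zs2 (3 * m - 4 * k) (3 * k - 2 * m))"
      "represents form12 (zs2 (3 * m - 4 * k) (2 * m - 3 * k))"
    if k: "k > 0" "m < 2 * k" "k^2 = n^2" for k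
  proof -
    have "16 * n^2 < 9 * m^2" using less.prems(2) zero_le_power2[of n] by linarith
    then have "(4 * k)^2 < (3 * m)^2" using k(3) by (simp add: power_mult_distrib)
    then have "4 * k < 3 * m" using less.prems(1) by (intro power2_less_imp_less[of "4 * k" "3 * m"]) auto
    moreover have "(3 * m - 4 * k)^2 - 2 * (3 * k - 2 * m)^2 = m^2 - 2 * k^2"
      "(3 * m - 4 * k)^2 - 2 * (2 * m - 3 * k)^2 = m^2 - 2 * k^2"
      by (simp_all add: power2_eq_square algebra_simps)
    then have "2 * (3 * k - 2 * m)^2 < (3 * m - 4 * k)^2" "2 * (2 * m - 3 * k)^2 < (3 * m - 4 * k)^2"
      using less.prems(2) k(3) by linarith+
    ultimately show "represents form12 (zs2 (3 * m - 4 * k) (3 * k - 2 * m))"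
      "represents form12 (zs2 (3 * m - 4 * k) (2 * m - 3 * k))"
      using k less.prems(1) less.hyps[of "3 * m - 4 * k"] by auto
  qed
  consider "n \<ge> 0" "m \<ge> 2 * n" | "n < 0" "m \<ge> - 2 * n"
    | "n > 0" "m < 2 * n" | "n < 0" "m < - 2 * n"
    using less.prems by linarith
  then show ?case
  proof cases
    case 1
    then show ?thesis by (intro represents_cone_zs2)
  next
    case 2
    then have "represents form12 (zs2 (3 * m + 4 * n) (2 * m + 3 * n))"
      using represents_cone_zs2(2)[of "- n" m] by simp
    from represents_div_eps[OF this] show ?thesis by (simp add: zs2_mult algebra_simps)
  next
    case 3
    from represents_mult_eps[OF step(1)[of n]] 3 show ?thesis by (simp add: zs2_mult algebra_simps)
  next
    case 4
    from represents_div_eps[OF step(2)[of "- n"]] 4 show ?thesis by (simp add: zs2_mult algebra_simps)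
  qed
qed

lemma form12_universal: "universal form12"
  unfolding universal_def by (metis OK_pos_E represents_zs2)


section \<open>Quadratic subforms\<close>

lemma beta_in_OK_pos: "beta \<in> OK_pos"
proof -
  have "sqrt 2 < 2" by (rule real_less_lsqrt) auto
  then show ?thesis
    unfolding OK_pos_def totally_pos_def beta_zs2
    by (simp add: zs2_in_OK tau_zs2) (simp add: zs2_def add_pos_pos)
qed

section \<open>The parity obstruction for sums of squares\<close>

definition even_part :: "real set" where
  "even_part = {zs2 a (2 * b) | a b. True}"

lemma even_part_sum: "(\<And>i. i \<in> A \<Longrightarrow> f i \<in> even_part) \<Longrightarrow> sum f A \<in> even_part"
proof (induction A rule: infinite_finite_induct)
  case (insert x F)
  then obtain a b c d where "f x = zs2 a (2 * b)" "sum f F = zs2 c (2 * d)"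
    unfolding even_part_def by blast
  then have "sum f (insert x F) = zs2 (a + c) (2 * (b + d))"
    using insert by (simp add: zs2_add algebra_simps)
  then show ?case unfolding even_part_def by blast
qed (auto simp: even_part_def zs2_def intro!: exI[of _ 0])

lemma square_in_even_part:
  assumes "x \<in> OK"
  shows "x * x \<in> even_part"
proof -
  obtain a b where "x = zs2 a b" using assms by (rule OK_E)
  then have "x * x = zs2 (a * a + 2 * b * b) (2 * (a * b))" by (simp add: zs2_mult)
  then show ?thesis unfolding even_part_def by blast
qed

lemma beta_notin_even_part: "beta \<notin> even_part"
proof
  assume "beta \<in> even_part"
  then obtain b :: int where "1 = 2 * b"
    unfolding even_part_def beta_zs2 by (auto simp: zs2_eq_iff)
  then show False by presburger
qed

lemma quadratic_subform_not_universal: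
  assumes "subform H form12" "gf_quadratic H"
  shows "\<not> universal H"
proof
  assume "universal H"
  then have "represents H beta" using beta_in_OK_pos by (simp add: universal_def)
  then obtain z where z: "\<forall>k<gvars H. z k \<in> OK" "gf_eval H z = beta"
    by (auto simp: represents_def)
  obtain p k where p: "p permutes {..<12}" "k \<le> 12"
    and H: "H = gf_restrict k (gf_reorder p form12)"
    using assms(1) by (auto simp: subform_def gvars_form12)
  define v where "v = (\<lambda>i. 2 * p (i div 2) + i mod 2)"
  have gH: "gvars H = k" and cH: "gcoeff H i j =
      (if i \<le> j \<and> j < 2 * k then monom_coeff (G0 form12) (v i) (v j) else 0)" for i j
    by (auto simp: H gf_restrict_def gf_reorder_def Let_def v_def)
  \<comment> \<open>Reordering and restriction keep the two diagonal coefficients of a z variable,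
    so a kept one would be proper in \<open>H\<close>.\<close>
  have p4: "p l < 4" if l: "l < k" for l
  proof (rule ccontr)
    assume "\<not> p l < 4"
    moreover have "p l < 12" using p l permutes_in_image[OF p(1), of l] by auto
    ultimately have "gcoeff H (2 * l) (2 * l) \<noteq> 0" "gcoeff H (2 * l + 1) (2 * l + 1) \<noteq> 0"
      using form12_coeff_g[of "p l"] l by (auto simp: cH v_def monom_coeff_def G0_def)
    then have "proper_var H l" using l gH by (intro proper_var_if_diagonal) auto
    then show False using assms(2) l gH by (auto simp: gf_quadratic_def)
  qed
  \<comment> \<open>The renumbering \<open>v\<close> is injective, preserves parity and here stays
    below 8, so \<open>H\<close> is exactly the sum of the squares of its variables.\<close>
  have coeff: "gcoeff H i j = (if i = j \<and> even i then 1 else 0)" if ij: "i \<le> j" "j < 2 * k" for i j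
  proof -
    have "i div 2 < k" "j div 2 < k" using ij by auto
    then have "v i < 8" "v j < 8" using p4[of "i div 2"] p4[of "j div 2"] unfolding v_def by linarith+
    moreover have "v i = v j \<longleftrightarrow> i = j"
    proof
      assume "v i = v j"
      then have "p (i div 2) = p (j div 2)" "i mod 2 = j mod 2" unfolding v_def by presburger+
      then have "i div 2 = j div 2" "i mod 2 = j mod 2"
        using permutes_inj[OF p(1)] by (auto dest: injD)
      then show "i = j" by (metis div_mult_mod_eq)
    qed simp
    moreover have "even (v i) \<longleftrightarrow> even i" by (simp add: v_def)
    ultimately show ?thesis
      using ij by (auto simp: cH monom_coeff_def G0_def form12_coeff_x min_def max_def)
  qed
  have "gf_eval H z = (\<Sum>i<2 * k. \<Sum>j\<in>{i..<2 * k}. if i = j \<and> even i then z (i div 2) * z (i div 2) else 0)"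
    unfolding gf_eval_def qf_eval_def G0_def qform.sel gH
    by (intro sum.cong refl) (auto simp: coeff)
  also have "\<dots> \<in> even_part"
  proof (intro even_part_sum)
    fix i j assume "i \<in> {..<2 * k}"
    then have "z (i div 2) \<in> OK" using z(1) gH by auto
    moreover have "0 \<in> even_part" using even_part_sum[of "{}"] by simp
    ultimately show "(if i = j \<and> even i then z (i div 2) * z (i div 2) else 0) \<in> even_part"
      using square_in_even_part by auto
  qed
  finally show False using z(2) beta_notin_even_part by simp
qed

theorem mainTheorem2:
  "gf_over_K form12 \<and> gf_integral form12 \<and>
   gf_totally_pos_semidef form12 \<and> universal form12 \<and>
   \<not> (\<exists>H. subform H form12 \<and> gf_quadratic H \<and> universal H)"
  using form12_over_K form12_integral form12_semidef form12_universal
    quadratic_subform_not_universal by blast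

end
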